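(* Let $\mathrm{a}_{n,k}^{\mathrm{asc}}(123,132)$ denote the number of permutations of $\{1,\dots,n\}$ that avoid both $123$ and $132$ and have exactly $k$ ascents. Then for all integers $n\ge1$ and $k\ge0$, $$\mathrm{a}_{n,k}^{\mathrm{asc}}(123,132)=\binom{n}{2k}.$$
   Context: $\mathcal{S}_n$ is the set of permutations $\pi=\pi_1\cdots\pi_n$ of $\{1,\dots,n\}$. For $\rho\in\mathcal{S}_m$, $\pi\in\mathcal{S}_n$ contains $\rho$ if there are indices $1\le i_1<\cdots<i_m\le n$ such that $\pi_{i_a}<\pi_{i_b}$ if and only if $\rho_a<\rho_b$; otherwise $\pi$ avoids $\rho$. The number of ascents is $\mathrm{asc}(\pi)=|\{i:\pi_i<\pi_{i+1}\}|$, where $1\le i\le n-1$. Binomial coefficients $\binom{m}{j}$ with $j>m\ge 0$ are $0$. *)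

theory Defs
  imports "HOL-Combinatorics.Multiset_Permutations"
begin

text \<open>
  Permutations are words in one-line notation: the permutation \<open>\<pi>\<^sub>1\<cdots>\<pi>\<^sub>n\<close> of \<open>{1..n}\<close> is the
  list of its values, an element of \<^term>\<open>permutations_of_set {1..n::nat}\<close>.  List positions
  start at \<open>0\<close>, so \<open>\<pi>\<^sub>i\<close> is \<open>\<pi> ! (i - 1)\<close>; the values themselves are \<open>1, \<dots>, n\<close>.
\<close>

definition contains_pattern :: "nat list \<Rightarrow> nat list \<Rightarrow> bool" where
  "contains_pattern \<pi> \<rho> \<longleftrightarrow>
     (\<exists>i. strict_mono_on {..<length \<rho>} i \<and> i ` {..<length \<rho>} \<subseteq> {..<length \<pi>} \<and>
        (\<forall>a<length \<rho>. \<forall>b<length \<rho>. \<pi> ! i a < \<pi> ! i b \<longleftrightarrow> \<rho> ! a < \<rho> ! b))"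

abbreviation avoids :: "nat list \<Rightarrow> nat list \<Rightarrow> bool" where
  "avoids \<pi> \<rho> \<equiv> \<not> contains_pattern \<pi> \<rho>"

definition asc :: "nat list \<Rightarrow> nat" where
  "asc \<pi> = card {i. Suc i < length \<pi> \<and> \<pi> ! i < \<pi> ! Suc i}"

definition a_asc :: "nat \<Rightarrow> nat \<Rightarrow> nat list set \<Rightarrow> nat" where
  "a_asc n k R =
     card {\<pi> \<in> permutations_of_set {1..n}. (\<forall>\<rho>\<in>R. avoids \<pi> \<rho>) \<and> asc \<pi> = k}"

end

theory Submission
  imports Defs
begin

text \<open>
  A permutation avoids both patterns iff every entry has at most one larger entry to its right.
  Hence the first entry is the largest or the second largest one, and deleting it leaves an
  arbitrary avoider of the remaining values. Splitting by whether the first entry is the maximum,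
  the two ascent counts for a set of size \<open>m\<close> are \<open>m - 1 choose 2 * k\<close> and
  \<open>m - 1 choose (2 * k - 1)\<close>, the latter read as \<open>0\<close>
  for \<open>k = 0\<close>; the recursion is Pascal's rule on both sides. Working with
  arbitrary finite sets of values makes standardisation unnecessary.
\<close>

fun at_most_one_larger_right :: "'a::linorder list \<Rightarrow> bool" where
  "at_most_one_larger_right [] \<longleftrightarrow> True"
| "at_most_one_larger_right (x # xs) \<longleftrightarrow>
     (\<forall>y\<in>set xs. \<forall>z\<in>set xs. x < y \<longrightarrow> x < z \<longrightarrow> y = z) \<and> at_most_one_larger_right xs"

lemma at_most_one_larger_right_iff_nth:
  assumes "distinct xs"
  shows "at_most_one_larger_right xs \<longleftrightarrow>
    \<not> (\<exists>a b c. a < b \<and> b < c \<and> c < length xs \<and> xs ! a < xs ! b \<and> xs ! a < xs ! c)"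
  using assms
proof (induction xs)
  case (Cons x xs)
  let ?bad = "\<lambda>xs a b c. a < b \<and> b < c \<and> c < length xs \<and> xs ! a < xs ! b \<and> xs ! a < xs ! c"
  have "(\<exists>a b c. ?bad (x # xs) a b c) \<longleftrightarrow>
      (\<exists>b c. b < c \<and> c < length xs \<and> x < xs ! b \<and> x < xs ! c) \<or> (\<exists>a b c. ?bad xs a b c)"
    (is "?L \<longleftrightarrow> ?R1 \<or> ?R2")
  proof
    assume ?L
    then obtain a b c where bad: "?bad (x # xs) a b c" by blast
    then obtain b' c' where "b = Suc b'" "c = Suc c'"
      by (metis less_zeroE not0_implies_Suc)
    with bad show "?R1 \<or> ?R2"
      by (cases a) auto
  next
    assume "?R1 \<or> ?R2"
    then show ?L
    proof
      assume ?R1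
      then obtain b c where "b < c \<and> c < length xs \<and> x < xs ! b \<and> x < xs ! c" by blast
      then have "?bad (x # xs) 0 (Suc b) (Suc c)" by simp
      then show ?L by blast
    next
      assume ?R2
      then obtain a b c where "?bad xs a b c" by blast
      then have "?bad (x # xs) (Suc a) (Suc b) (Suc c)" by simp
      then show ?L by blast
    qed
  qed
  moreover have "?R1 \<longleftrightarrow> \<not> (\<forall>y\<in>set xs. \<forall>z\<in>set xs. x < y \<longrightarrow> x < z \<longrightarrow> y = z)"
  proof
    assume ?R1
    then obtain b c where "b < c" "c < length xs" "x < xs ! b" "x < xs ! c" by blast
    moreover from this have "xs ! b \<noteq> xs ! c"
      using Cons.prems by (simp add: nth_eq_iff_index_eq)
    ultimately show "\<not> (\<forall>y\<in>set xs. \<forall>z\<in>set xs. x < y \<longrightarrow> x < z \<longrightarrow> y = z)"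
      by (meson nth_mem order.strict_trans)
  next
    assume "\<not> (\<forall>y\<in>set xs. \<forall>z\<in>set xs. x < y \<longrightarrow> x < z \<longrightarrow> y = z)"
    then obtain b c where "b < length xs" "c < length xs" "x < xs ! b" "x < xs ! c" "b \<noteq> c"
      by (metis in_set_conv_nth)
    then show ?R1
      by (metis nat_neq_iff)
  qed
  ultimately show ?case
    using Cons by simp
qed simp

lemma contains_pattern_length3:
  "contains_pattern \<pi> [p, q, r] \<longleftrightarrow>
    (\<exists>a b c. a < b \<and> b < c \<and> c < length \<pi> \<and>
      (\<pi> ! a < \<pi> ! b \<longleftrightarrow> p < q) \<and> (\<pi> ! b < \<pi> ! a \<longleftrightarrow> q < p) \<and>
      (\<pi> ! a < \<pi> ! c \<longleftrightarrow> p < r) \<and> (\<pi> ! c < \<pi> ! a \<longleftrightarrow> r < p) \<and>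
      (\<pi> ! b < \<pi> ! c \<longleftrightarrow> q < r) \<and> (\<pi> ! c < \<pi> ! b \<longleftrightarrow> r < q))" (is "_ \<longleftrightarrow> ?R")
proof -
  have len: "length [p, q, r] = Suc (Suc (Suc 0))" by simp
  show ?thesis
  proof
    assume "contains_pattern \<pi> [p, q, r]"
    then obtain i where i: "strict_mono_on {..<3} i" "i ` {..<3} \<subseteq> {..<length \<pi>}"
      and iso: "\<forall>a<Suc (Suc (Suc 0)). \<forall>b<Suc (Suc (Suc 0)).
        \<pi> ! i a < \<pi> ! i b \<longleftrightarrow> [p, q, r] ! a < [p, q, r] ! b"
      unfolding contains_pattern_def len by (auto simp: numeral_3_eq_3)
    have "i 0 < i 1" "i 1 < i 2" "i 2 < length \<pi>"
      using i by (auto simp: strict_mono_on_def image_subset_iff)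
    with iso show ?R
      by (intro exI[of _ "i 0"] exI[of _ "i 1"] exI[of _ "i 2"])
         (simp add: All_less_Suc2 numeral_2_eq_2)
  next
    assume ?R
    then obtain a b c where "a < b" "b < c" "c < length \<pi>"
      "\<pi> ! a < \<pi> ! b \<longleftrightarrow> p < q" "\<pi> ! b < \<pi> ! a \<longleftrightarrow> q < p"
      "\<pi> ! a < \<pi> ! c \<longleftrightarrow> p < r" "\<pi> ! c < \<pi> ! a \<longleftrightarrow> r < p"
      "\<pi> ! b < \<pi> ! c \<longleftrightarrow> q < r" "\<pi> ! c < \<pi> ! b \<longleftrightarrow> r < q"
      by blast
    then show "contains_pattern \<pi> [p, q, r]"
      unfolding contains_pattern_def len
      by (intro exI[of _ "(!) [a, b, c]"] conjI)
         (auto simp: strict_mono_on_def less_Suc_eq)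
  qed
qed

lemma avoids_123_132_iff:
  assumes "distinct \<pi>"
  shows "avoids \<pi> [1, 2, 3] \<and> avoids \<pi> [1, 3, 2] \<longleftrightarrow> at_most_one_larger_right \<pi>"
proof -
  have ne: "\<pi> ! b < \<pi> ! c \<or> \<pi> ! c < \<pi> ! b" if "b < c" "c < length \<pi>" for b c
    using assms that by (metis less_trans linorder_neqE_nat nat_less_le nth_eq_iff_index_eq)
  let ?pat = "\<lambda>P. \<exists>a b c. a < b \<and> b < c \<and> c < length \<pi> \<and> \<pi> ! a < \<pi> ! b \<and> \<pi> ! a < \<pi> ! c \<and> P b c"
  have "contains_pattern \<pi> [1, 2, 3] \<longleftrightarrow> ?pat (\<lambda>b c. \<pi> ! b < \<pi> ! c)"
    unfolding contains_pattern_length3 by (intro arg_cong[of _ _ Ex] ext) auto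
  moreover have "contains_pattern \<pi> [1, 3, 2] \<longleftrightarrow> ?pat (\<lambda>b c. \<pi> ! c < \<pi> ! b)"
    unfolding contains_pattern_length3 by (intro arg_cong[of _ _ Ex] ext) auto
  ultimately show ?thesis
    unfolding at_most_one_larger_right_iff_nth[OF assms] using ne by blast
qed

lemma asc_Nil [simp]: "asc [] = 0"
  by (simp add: asc_def)

lemma asc_single [simp]: "asc [x] = 0"
  by (simp add: asc_def)

lemma asc_Cons:
  assumes "xs \<noteq> []"
  shows "asc (x # xs) = (if x < hd xs then Suc (asc xs) else asc xs)"
proof -
  let ?A = "\<lambda>xs. {i. Suc i < length xs \<and> xs ! i < xs ! Suc i}"
  have fin: "finite (?A xs)"
    by (rule finite_subset[of _ "{..<length xs}"]) auto
  have "?A (x # xs) = (if x < hd xs then {0} else {}) \<union> Suc ` ?A xs"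
  proof (rule set_eqI)
    fix i show "i \<in> ?A (x # xs) \<longleftrightarrow> i \<in> (if x < hd xs then {0} else {}) \<union> Suc ` ?A xs"
      using assms by (cases i) (auto simp: hd_conv_nth)
  qed
  with fin show ?thesis
    by (simp add: asc_def card_image)
qed

definition avoiders :: "nat set \<Rightarrow> nat \<Rightarrow> nat list set" where
  "avoiders S k = {xs \<in> permutations_of_set S. at_most_one_larger_right xs \<and> asc xs = k}"

lemma finite_avoiders [simp]: "finite (avoiders S k)"
  by (simp add: avoiders_def)

lemma avoiders_Cons_iff:
  "x # xs \<in> avoiders S k \<longleftrightarrow> x \<in> S \<and> xs \<in> permutations_of_set (S - {x}) \<and>
     (\<forall>y\<in>S. \<forall>z\<in>S. x < y \<longrightarrow> x < z \<longrightarrow> y = z) \<and> at_most_one_larger_right xs \<and> asc (x # xs) = k"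
  by (auto simp: avoiders_def permutations_of_set_def)

lemma hd_perm:
  assumes "xs \<in> permutations_of_set S" "finite S" "card S = Suc m"
  shows "xs \<noteq> []" "hd xs \<in> S"
proof -
  show "xs \<noteq> []"
    using assms by (auto simp: permutations_of_set_def)
  then show "hd xs \<in> S"
    using assms hd_in_set permutations_of_setD(1) by blast
qed

lemma card_avoiders_by_hd:
  assumes "finite S" "card S = Suc m"
  shows "card {xs \<in> avoiders S k. hd xs = Max S} = m choose (2 * k)"
    and "card {xs \<in> avoiders S k. hd xs \<noteq> Max S} = (if k = 0 then 0 else m choose (2 * k - 1))"
  using assms
proof (induction m arbitrary: S k)
  case 0
  {
    case 1
    then obtain x where "S = {x}"
      by (auto simp: card_Suc_eq)
    then have "{xs \<in> avoiders S k. hd xs = Max S} = (if k = 0 then {[x]} else {})"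
      by (auto simp: avoiders_def)
    then show ?case by simp
  next
    case 2
    then obtain x where "S = {x}"
      by (auto simp: card_Suc_eq)
    then have empty: "{xs \<in> avoiders S k. hd xs \<noteq> Max S} = {}"
      by (auto simp: avoiders_def)
    show ?case unfolding empty by simp
  }
next
  case (Suc m)
  {
    case 1
    define M where "M = Max S"
    have M: "M \<in> S" "\<And>y. y \<in> S \<Longrightarrow> y \<le> M"
      using 1 unfolding M_def by (auto intro!: Max_in)
    let ?S = "S - {M}"
    have S: "finite ?S" "card ?S = Suc m"
      using 1 M by auto
    have asc_M: "asc (M # xs) = asc xs" if "xs \<in> permutations_of_set ?S" for xs
    proof -
      have "xs \<noteq> []" "hd xs \<in> S"
        using hd_perm[OF that S] by auto
      with M show ?thesis by (simp add: asc_Cons leD)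
    qed
    have "{xs \<in> avoiders S k. hd xs = M} = (#) M ` avoiders ?S k"
    proof (rule set_eqI)
      fix xs
      show "xs \<in> {xs \<in> avoiders S k. hd xs = M} \<longleftrightarrow> xs \<in> (#) M ` avoiders ?S k"
      proof (cases xs)
        case Nil
        then show ?thesis using M by (auto simp: avoiders_def permutations_of_set_def)
      next
        case (Cons x ys)
        have "xs \<in> {xs \<in> avoiders S k. hd xs = M} \<longleftrightarrow> x = M \<and> ys \<in> avoiders ?S k"
          using M asc_M[of ys] unfolding Cons mem_Collect_eq avoiders_Cons_iff
          by (auto simp: avoiders_def dest: leD)
        then show ?thesis unfolding Cons by blast
      qed
    qed
    then have "card {xs \<in> avoiders S k. hd xs = M} = card (avoiders ?S k)"
      by (simp add: card_image)
    also have "avoiders ?S k = {xs \<in> avoiders ?S k. hd xs = Max ?S} \<union>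
        {xs \<in> avoiders ?S k. hd xs \<noteq> Max ?S}"
      by auto
    also have "card \<dots> = (m choose (2 * k)) + (if k = 0 then 0 else m choose (2 * k - 1))"
      by (subst card_Un_disjoint) (auto simp only: Suc.IH[OF S], auto)
    also have "\<dots> = Suc m choose (2 * k)"
      by (cases k) auto
    finally show ?case by (simp add: M_def)
  next
    case 2
    define M where "M = Max S"
    have M: "M \<in> S" "\<And>y. y \<in> S \<Longrightarrow> y \<le> M"
      using 2 unfolding M_def by (auto intro!: Max_in)
    have SM: "finite (S - {M})" "card (S - {M}) = Suc m"
      using 2 M by auto
    define x where "x = Max (S - {M})"
    have "x \<in> S - {M}"
      using SM unfolding x_def by (metis Max_in card.empty nat.distinct(1))
    then have x: "x \<in> S" "x < M"
      using M by force+
    have larger: "x < y \<longleftrightarrow> y = M" if "y \<in> S" for y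
      using that x SM Max_ge[of "S - {M}" y] unfolding x_def by fastforce
    let ?S = "S - {x}"
    have S: "finite ?S" "card ?S = Suc m"
      using 2 x by auto
    have Max_S: "Max ?S = M"
      using M x S by (intro Max_eqI) auto
    let ?T = "{xs \<in> avoiders ?S k. hd xs \<noteq> Max ?S} \<union>
      (if k = 0 then {} else {xs \<in> avoiders ?S (k - 1). hd xs = Max ?S})"
    have asc_x: "asc (x # xs) = (if hd xs = M then Suc (asc xs) else asc xs)"
      if "xs \<in> permutations_of_set ?S" for xs
    proof -
      have "xs \<noteq> []" "hd xs \<in> S"
        using hd_perm[OF that S] by auto
      then show ?thesis by (simp add: asc_Cons larger)
    qed
    have first: "y \<in> S \<and> y \<noteq> M \<and> (\<forall>u\<in>S. \<forall>v\<in>S. y < u \<longrightarrow> y < v \<longrightarrow> u = v) \<longleftrightarrow> y = x" for y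
      using x M larger by (metis less_le linorder_neqE_nat)
    have "{xs \<in> avoiders S k. hd xs \<noteq> M} = (#) x ` ?T"
    proof (rule set_eqI)
      fix xs
      show "xs \<in> {xs \<in> avoiders S k. hd xs \<noteq> M} \<longleftrightarrow> xs \<in> (#) x ` ?T"
      proof (cases xs)
        case Nil
        then show ?thesis using M by (auto simp: avoiders_def permutations_of_set_def)
      next
        case (Cons y ys)
        have "xs \<in> {xs \<in> avoiders S k. hd xs \<noteq> M} \<longleftrightarrow>
            y = x \<and> ys \<in> permutations_of_set ?S \<and> at_most_one_larger_right ys \<and> asc (x # ys) = k"
          unfolding Cons mem_Collect_eq avoiders_Cons_iff list.sel using first[of y] by blast
        also have "\<dots> \<longleftrightarrow> y = x \<and> ys \<in> ?T"
          using asc_x[of ys] unfolding Max_S by (auto simp: avoiders_def split: if_splits)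
        finally show ?thesis unfolding Cons by blast
      qed
    qed
    then have "card {xs \<in> avoiders S k. hd xs \<noteq> M} = card ?T"
      by (simp add: card_image)
    also have "\<dots> = (if k = 0 then 0 else m choose (2 * k - 1)) +
        (if k = 0 then 0 else m choose (2 * (k - 1)))"
      by (subst card_Un_disjoint) (auto simp only: Suc.IH[OF S] split: if_splits, auto)
    also have "\<dots> = (if k = 0 then 0 else Suc m choose (2 * k - 1))"
      by (cases k) auto
    finally show ?case by (simp add: M_def)
  }
qed

theorem proposition13:
  fixes n k :: nat
  assumes "n \<ge> 1"
  shows "a_asc n k {[1, 2, 3], [1, 3, 2]} = n choose (2 * k)"
proof -
  obtain m where n: "n = Suc m"
    using assms by (cases n) auto
  let ?S = "{1..n}"
  have S: "finite ?S" "card ?S = Suc m"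
    using n by auto
  have "a_asc n k {[1, 2, 3], [1, 3, 2]} = card (avoiders ?S k)"
    unfolding a_asc_def avoiders_def
    by (rule arg_cong[of _ _ card])
       (use avoids_123_132_iff in \<open>auto simp: permutations_of_set_def\<close>)
  also have "avoiders ?S k = {xs \<in> avoiders ?S k. hd xs = Max ?S} \<union>
      {xs \<in> avoiders ?S k. hd xs \<noteq> Max ?S}"
    by auto
  also have "card \<dots> = (m choose (2 * k)) + (if k = 0 then 0 else m choose (2 * k - 1))"
    by (subst card_Un_disjoint) (auto simp only: card_avoiders_by_hd[OF S], auto)
  also have "\<dots> = n choose (2 * k)"
    unfolding n by (cases k) auto
  finally show ?thesis .
qed

end
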